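(* Let $\Pi$ be the unique solution of $A\Pi+BL=\Pi S$ and let $\Upsilon_{\mathbf D}$ be the unique solution of $S_{\mathbf D}\Upsilon_{\mathbf D}=\Upsilon_{\mathbf D}A+RC$. Consider a model $\Sigma_G:\ \dot\xi=(S-GL)\xi+Gu,\ \psi=C\Pi\xi$, with transfer function $K_G$. Then the $\mu$ moments of order $1:j_i+1$ of $K_G$ at $\sigma(S_{\mathbf D})$ match the $\mu$ moments of order $1:j_i+1$ of $K$ at $\sigma(S_{\mathbf D})\subset\sigma(S)$ (in the sense defined in the context) if and only if $$\Upsilon_{\mathbf D}\Pi G=\Upsilon_{\mathbf D}B.$$
   Context: $\sigma(M)$ denotes the spectrum of a matrix $M$. The single-input single-output system $\dot x=Ax+Bu,\ y=Cx$ has $A\in\mathbb{R}^{n\times n}$, $B\in\mathbb{R}^{n\times 1}$, $C\in\mathbb{R}^{1\times n}$, is controllable and observable, and is stable (all eigenvalues of $A$ have negative real part). Its transfer function is $K(s)=C(sI-A)^{-1}B$. $S\in\mathbb{C}^{\nu\times\nu}$ has spectrum closed under complex conjugation with $\sigma(S)\cap\sigma(A)=\emptyset$, its eigenvalues $s_i$ have multiplicities $j_i+1$, and $L\in\mathbb{C}^{1\times\nu}$ is such that $(L,S)$ is observable. Write $S=\operatorname{diag}(S_p,S_{\mathbf D})$ with $S_{\mathbf D}\in\mathbb{R}^{\mu\times\mu}$, $\mu\le\nu$, and $L=[L_1^T\ L_2^T]$ with $L_2\in\mathbb{C}^{\mu}$. Set $R=L_2$, and assume $(S_{\mathbf D},R)$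 is controllable. Then $\Pi\in\mathbb{C}^{n\times\nu}$ and $\Upsilon_{\mathbf D}\in\mathbb{C}^{\mu\times n}$. The parameter $G\in\mathbb{C}^{\nu}$ is such that $\sigma(S-GL)\cap\sigma(S)=\emptyset$, and $K_G(s)=C\Pi(sI-S+GL)^{-1}G$. The derivative $K_G'=\mathrm{d}K_G/\mathrm{d}s$ has the realization $$\Sigma'_G:\quad \dot\xi=(S-GL)\xi+Gu,\quad \dot\chi=(S-GL)\chi+\xi,\quad \eta=-C\Pi\chi.$$ Interconnect $\Sigma'_G$ with the signal generator $\dot\omega=S\omega,\ \theta=L\omega$ via $u=\theta$, and with the generalized signal generator $\dot\varpi=S_{\mathbf D}\varpi+Rw$, $\varpi(0)=0$, $\varpi(t)\in\mathbb{C}^\mu$, via $w=-\eta=C\Pi\chi$. Definition (matching of the higher-order moments). The $\mu$ moments of order $1:j_i+1$ of $K_G$ are said to match those of $K$ at $\sigma(S_{\mathbf D})$ if there is a matrix $P\in\mathbb{C}^{\mu\times\nu}$ such that the signal $\zeta(t)=\varpi(t)+P\chi(t)$ satisfies $\dot\zeta=S_{\mathbf D}\zeta+\Upsilon_{\mathbf D}\Pi\xi$ along all trajectories of the interconnection, i.e. for all values of $\xi$ and $\chi$ (arbitrary initial states $\xi(0),\chi(0)\in\mathbb{C}^\nu$). *)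

theory Defs
  imports
    Complex_Main
    "Jordan_Normal_Form.Spectral_Radius"
    "Jordan_Normal_Form.DL_Rank"
begin

abbreviation complex_mat :: "real mat \<Rightarrow> complex mat" where
  "complex_mat \<equiv> map_mat complex_of_real"

text \<open>
  Kalman matrices: for \<open>A\<close> of size \<open>n \<times> n\<close>, \<open>[B, A B, \<dots>, A\<^sup>n\<^sup>-\<^sup>1 B]\<close> for \<open>B\<close> of size
  \<open>n \<times> m\<close>, and the matrices \<open>C, C A, \<dots>, C A\<^sup>n\<^sup>-\<^sup>1\<close> stacked on top of each other for \<open>C\<close>
  of size \<open>p \<times> n\<close>.
\<close>

definition controllability_mat :: "'a::field mat \<Rightarrow> 'a mat \<Rightarrow> 'a mat" where
  "controllability_mat A B =
     (let n = dim_row A; m = dim_col B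
      in mat n (n * m) (\<lambda>(i, j). (A ^\<^sub>m (j div m) * B) $$ (i, j mod m)))"

definition observability_mat :: "'a::field mat \<Rightarrow> 'a mat \<Rightarrow> 'a mat" where
  "observability_mat C A =
     (let n = dim_row A; p = dim_row C
      in mat (n * p) n (\<lambda>(i, j). (C * A ^\<^sub>m (i div p)) $$ (i mod p, j)))"

definition controllable :: "'a::field mat \<Rightarrow> 'a mat \<Rightarrow> bool" where
  "controllable A B \<longleftrightarrow>
     vec_space.rank (dim_row A) (controllability_mat A B) = dim_row A"

text \<open>The first argument of \<open>vec_space.rank\<close> is the number of rows of the matrix.\<close>

definition observable :: "'a::field mat \<Rightarrow> 'a mat \<Rightarrow> bool" where
  "observable C A \<longleftrightarrow>
     vec_space.rank (dim_row A * dim_row C) (observability_mat C A) = dim_row A"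

definition hurwitz_stable :: "real mat \<Rightarrow> bool" where
  "hurwitz_stable A \<longleftrightarrow> (\<forall>s \<in> spectrum (complex_mat A). Re s < 0)"

text \<open>
  \<open>vec_ode n x f\<close>: on the time axis \<open>t \<ge> 0\<close>, the \<open>\<complex>\<^sup>n\<close>-valued signal \<open>x\<close> is differentiable
  (one-sided at \<open>t = 0\<close>) with derivative \<open>f\<close>.  The library type of vectors carries no topology,
  so the derivative is taken entrywise.
\<close>

definition vec_ode ::
  "nat \<Rightarrow> (real \<Rightarrow> complex vec) \<Rightarrow> (real \<Rightarrow> complex vec) \<Rightarrow> bool" where
  "vec_ode n x f \<longleftrightarrow>
     (\<forall>t \<ge> 0. x t \<in> carrier_vec n \<and> f t \<in> carrier_vec n \<and>
        (\<forall>i < n. ((\<lambda>\<tau>. x \<tau> $ i) has_vector_derivative f t $ i) (at t within {0..})))"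

text \<open>
  Trajectories of the interconnection for a model \<open>K\<^sub>G(s) = H (s I - F)\<^sup>-\<^sup>1 G\<close>.  The equations for
  \<open>\<xi>\<close>, \<open>\<chi>\<close>, \<open>\<eta>\<close> realize \<open>K\<^sub>G'(s) = - H (s I - F)\<^sup>-\<^sup>2 G\<close>.  This system is driven by the signal
  generator \<open>(S, L)\<close> through \<open>u = \<theta>\<close>, and its output drives the generalized signal generator
  \<open>(D, R)\<close> through \<open>w = - \<eta>\<close>.  The initial states of \<open>\<omega>\<close>, \<open>\<xi>\<close> and \<open>\<chi>\<close> are arbitrary.
\<close>

definition derivative_interconnection ::
  "nat \<Rightarrow> nat \<Rightarrow> complex mat \<Rightarrow> complex mat \<Rightarrow> complex mat \<Rightarrow> complex mat \<Rightarrow> complex mat \<Rightarrow>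
   complex mat \<Rightarrow> complex mat \<Rightarrow> (real \<Rightarrow> complex vec) \<Rightarrow> (real \<Rightarrow> complex vec) \<Rightarrow>
   (real \<Rightarrow> complex vec) \<Rightarrow> (real \<Rightarrow> complex vec) \<Rightarrow> bool" where
  "derivative_interconnection \<nu> \<mu> F G H S L D R \<omega> \<xi> \<chi> \<phi> \<longleftrightarrow>
     (let \<theta> = (\<lambda>t. L *\<^sub>v \<omega> t);
          u = \<theta>;
          \<eta> = (\<lambda>t. - (H *\<^sub>v \<chi> t));
          w = (\<lambda>t. - \<eta> t)
      in vec_ode \<nu> \<omega> (\<lambda>t. S *\<^sub>v \<omega> t) \<and>
         vec_ode \<nu> \<xi> (\<lambda>t. F *\<^sub>v \<xi> t + G *\<^sub>v u t) \<and>
         vec_ode \<nu> \<chi> (\<lambda>t. F *\<^sub>v \<chi> t + \<xi> t) \<and>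
         vec_ode \<mu> \<phi> (\<lambda>t. D *\<^sub>v \<phi> t + R *\<^sub>v w t) \<and>
         \<phi> 0 = 0\<^sub>v \<mu>)"

text \<open>
  Matching of the higher-order moments at \<open>\<sigma>(D)\<close>.  The transfer function \<open>K\<^sub>G\<close> enters through
  its realization \<open>(S - G L, G, C \<Pi>\<^sub>S)\<close>, and the transfer function \<open>K\<close> of \<open>(A, B, C)\<close> through
  \<open>\<Pi>\<^sub>S\<close> and \<open>\<Upsilon>\<close>.
\<close>

definition higher_moments_match ::
  "nat \<Rightarrow> nat \<Rightarrow> complex mat \<Rightarrow> complex mat \<Rightarrow> complex mat \<Rightarrow> complex mat \<Rightarrow> complex mat \<Rightarrow>
   complex mat \<Rightarrow> complex mat \<Rightarrow> complex mat \<Rightarrow> bool" where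
  "higher_moments_match \<nu> \<mu> S L G C D R \<Pi>\<^sub>S \<Upsilon> \<longleftrightarrow>
     (\<exists>P \<in> carrier_mat \<mu> \<nu>. \<forall>\<omega> \<xi> \<chi> \<phi>.
        derivative_interconnection \<nu> \<mu> (S - G * L) G (C * \<Pi>\<^sub>S) S L D R \<omega> \<xi> \<chi> \<phi> \<longrightarrow>
        (let \<zeta> = (\<lambda>t. \<phi> t + P *\<^sub>v \<chi> t)
         in vec_ode \<mu> \<zeta> (\<lambda>t. D *\<^sub>v \<zeta> t + (\<Upsilon> * \<Pi>\<^sub>S) *\<^sub>v \<xi> t)))"

end

theory Submission
  imports "HOL-Analysis.Derivative" Defs
begin

text \<open>
  Put \<open>F = S - G L\<close>.  Along a trajectory, \<open>\<zeta> = \<phi> + P \<chi>\<close> satisfies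
  \<open>\<zeta>' = D \<phi> + (R C \<Pi> + P F) \<chi> + P \<xi>\<close>.  Since the initial states \<open>\<xi>(0)\<close> and \<open>\<chi>(0)\<close> are
  arbitrary, comparing with \<open>D \<zeta> + \<Upsilon> \<Pi> \<xi>\<close> at \<open>t = 0\<close> forces \<open>P = \<Upsilon> \<Pi>\<close> and
  \<open>R C \<Pi> + P F = D P\<close>.  The two Sylvester equations turn the latter into
  \<open>(\<Upsilon> B - \<Upsilon> \<Pi> G) L = 0\<close>, and the row \<open>L\<close> is nonzero by observability.
\<close>

unbundle no vec_syntax \<comment> \<open>\<open>$\<close> is indexing of \<open>Matrix.vec\<close>; importing \<open>Defs\<close> last gives its type \<open>vec\<close> precedence\<close>

section \<open>Calculus for entrywise differentiable signals\<close>

lemma vec_ode_add: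
  assumes "vec_ode n x f" "vec_ode n y g"
  shows "vec_ode n (\<lambda>t. x t + y t) (\<lambda>t. f t + g t)"
  unfolding vec_ode_def
proof (intro allI impI conjI)
  fix t :: real assume t: "t \<ge> 0"
  show "x t + y t \<in> carrier_vec n" "f t + g t \<in> carrier_vec n"
    using assms t by (auto simp: vec_ode_def)
  fix i assume i: "i < n"
  have "((\<lambda>\<tau>. x \<tau> $ i + y \<tau> $ i) has_vector_derivative (f t $ i + g t $ i)) (at t within {0..})"
    using assms t i by (intro has_vector_derivative_add) (auto simp: vec_ode_def)
  moreover have "f t $ i + g t $ i = (f t + g t) $ i"
    using assms t i by (auto simp: vec_ode_def)
  \<comment> \<open>For negative \<tau> the dimensions of the two signals are unconstrained, so
    indexing commutes with addition only on the time axis. Hence the transfer lemma relative to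
    \<open>{0..}\<close>.\<close>
  moreover have "x \<tau> $ i + y \<tau> $ i = (x \<tau> + y \<tau>) $ i" if "\<tau> \<in> {0..}" for \<tau>
    using assms that i by (auto simp: vec_ode_def)
  ultimately show "((\<lambda>\<tau>. (x \<tau> + y \<tau>) $ i) has_vector_derivative (f t + g t) $ i) (at t within {0..})"
    using t by (metis (no_types, lifting) atLeast_iff has_vector_derivative_transform)
qed

lemma index_mult_mat_vec_sum:
  assumes "P \<in> carrier_mat m n" "v \<in> carrier_vec n" "i < m"
  shows "(P *\<^sub>v v) $ i = (\<Sum>j<n. P $$ (i, j) * v $ j)"
  using assms by (auto simp: scalar_prod_def lessThan_atLeast0 intro!: sum.cong)

lemma mult_mat_zero_vec: "A \<in> carrier_mat m n \<Longrightarrow> A *\<^sub>v 0\<^sub>v n = 0\<^sub>v m"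
  by (intro eq_vecI) auto

lemma vec_ode_mult_mat:
  assumes P: "P \<in> carrier_mat m n" and x: "vec_ode n x f"
  shows "vec_ode m (\<lambda>t. P *\<^sub>v x t) (\<lambda>t. P *\<^sub>v f t)"
  unfolding vec_ode_def
proof (intro allI impI conjI)
  fix t :: real assume t: "t \<ge> 0"
  show "P *\<^sub>v x t \<in> carrier_vec m" "P *\<^sub>v f t \<in> carrier_vec m"
    using P x t by (auto simp: vec_ode_def)
  fix i assume i: "i < m"
  have "((\<lambda>\<tau>. \<Sum>j<n. P $$ (i, j) * x \<tau> $ j) has_vector_derivative (\<Sum>j<n. P $$ (i, j) * f t $ j))
      (at t within {0..})"
    using x t by (intro has_vector_derivative_sum has_vector_derivative_mult_right) (auto simp: vec_ode_def)
  moreover have "(P *\<^sub>v x \<tau>) $ i = (\<Sum>j<n. P $$ (i, j) * x \<tau> $ j)" if "\<tau> \<in> {0..}" for \<tau>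
    using x that by (intro index_mult_mat_vec_sum[OF P _ i]) (auto simp: vec_ode_def)
  moreover have "(P *\<^sub>v f t) $ i = (\<Sum>j<n. P $$ (i, j) * f t $ j)"
    using x t by (intro index_mult_mat_vec_sum[OF P _ i]) (auto simp: vec_ode_def)
  ultimately show "((\<lambda>\<tau>. (P *\<^sub>v x \<tau>) $ i) has_vector_derivative (P *\<^sub>v f t) $ i) (at t within {0..})"
    using t by (metis (no_types, lifting) atLeast_iff has_vector_derivative_transform)
qed

text \<open>Derivatives are taken within \<open>{0..}\<close>, so values at negative times are
  irrelevant and agreement for nonnegative times suffices.\<close>

lemma vec_ode_cong:
  assumes x: "vec_ode n x f" and xy: "\<And>t. t \<ge> 0 \<Longrightarrow> x t = y t" and fg: "\<And>t. t \<ge> 0 \<Longrightarrow> f t = g t"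
  shows "vec_ode n y g"
  unfolding vec_ode_def
proof (intro allI impI conjI)
  fix t :: real assume t: "t \<ge> 0"
  show "y t \<in> carrier_vec n" "g t \<in> carrier_vec n"
    using x t unfolding vec_ode_def xy[OF t, symmetric] fg[OF t, symmetric] by auto
  fix i assume "i < n"
  hence "((\<lambda>\<tau>. x \<tau> $ i) has_vector_derivative g t $ i) (at t within {0..})"
    using x t unfolding vec_ode_def fg[OF t, symmetric] by auto
  thus "((\<lambda>\<tau>. y \<tau> $ i) has_vector_derivative g t $ i) (at t within {0..})"
    by (rule has_vector_derivative_transform[rotated 2]) (use t in \<open>simp_all add: xy\<close>)
qed

text \<open>The filter \<open>at 0 within {0..}\<close> is the nontrivial right-sided one, so
  one-sided derivatives at 0 are unique. Time 0 matters because the states can be prescribed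
  there.\<close>

lemma vec_ode_unique_at_0:
  assumes "vec_ode n x f" "vec_ode n x g"
  shows "f 0 = g 0"
proof (rule eq_vecI)
  show "dim_vec (f 0) = dim_vec (g 0)"
    using assms by (force simp: vec_ode_def)
  fix i assume "i < dim_vec (g 0)"
  hence "i < n" using assms by (force simp: vec_ode_def)
  thus "f 0 $ i = g 0 $ i"
    using assms unfolding vec_ode_def
    by (intro vector_derivative_unique_within[where x = 0 and S = "{0..}" and f = "\<lambda>\<tau>. x \<tau> $ i"])
       (auto simp: at_within_Ici_at_right)
qed

section \<open>Solving linear systems by the matrix exponential\<close>

text \<open>Geometric growth is what makes the exponential series converge. The constants are crude:
  \<open>b\<close>, the sum of the moduli of all entries of \<open>M\<close>, dominates every row
  sum, and \<open>K\<close> dominates every entry of \<open>v\<close>.\<close>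

lemma mat_vec_power_bound:
  fixes M :: "complex mat"
  assumes M: "M \<in> carrier_mat n n" and v: "v \<in> carrier_vec n"
  obtains K b where "\<And>k i. i < n \<Longrightarrow> norm ((((\<lambda>v. M *\<^sub>v v) ^^ k) v) $ i) \<le> K * b ^ k"
proof -
  define b where "b = (\<Sum>i<n. \<Sum>j<n. norm (M $$ (i, j)))"
  define K where "K = (\<Sum>i<n. norm (v $ i))"
  have carrier: "((\<lambda>v. M *\<^sub>v v) ^^ k) v \<in> carrier_vec n" for k
    by (induction k) (use M v in auto)
  have row: "(\<Sum>j<n. norm (M $$ (i, j))) \<le> b" if "i < n" for i
    unfolding b_def using that
    by (intro member_le_sum[where f = "\<lambda>i. \<Sum>j<n. norm (M $$ (i, j))"]) (auto intro: sum_nonneg)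
  have nonneg: "0 \<le> K" "0 \<le> b"
    unfolding b_def K_def by (auto intro!: sum_nonneg)
  have "norm ((((\<lambda>v. M *\<^sub>v v) ^^ k) v) $ i) \<le> K * b ^ k" if "i < n" for k i
    using that
  proof (induction k arbitrary: i)
    case 0
    thus ?case unfolding K_def by (auto intro: member_le_sum)
  next
    case (Suc k)
    let ?w = "((\<lambda>v. M *\<^sub>v v) ^^ k) v"
    have "norm ((M *\<^sub>v ?w) $ i) \<le> (\<Sum>j<n. norm (M $$ (i, j)) * norm (?w $ j))"
      unfolding index_mult_mat_vec_sum[OF M carrier Suc.prems]
      by (rule order_trans[OF norm_sum]) (simp add: norm_mult)
    also have "\<dots> \<le> (\<Sum>j<n. norm (M $$ (i, j)) * (K * b ^ k))"
      by (intro sum_mono mult_left_mono Suc.IH) auto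
    also have "\<dots> \<le> b * (K * b ^ k)"
      unfolding sum_distrib_right[symmetric]
      using row[OF Suc.prems] nonneg by (intro mult_right_mono) auto
    finally show ?case by (simp add: mult_ac)
  qed
  thus thesis by (rule that)
qed

text \<open>The solution is exp(tM)v, written as one scalar power series per entry:
  \<open>a i k\<close> is the k-th Taylor coefficient of entry \<open>i\<close>. Membership in the
  carrier is provided for negative times too, so that later rewriting needs no side condition on
  \<open>t\<close>.\<close>

lemma linear_vec_ode_solvable:
  fixes M :: "complex mat"
  assumes M: "M \<in> carrier_mat n n" and v: "v \<in> carrier_vec n"
  obtains x where "x 0 = v" "vec_ode n x (\<lambda>t. M *\<^sub>v x t)" "\<And>t. x t \<in> carrier_vec n"
proof -
  define c where "c k = ((\<lambda>v. M *\<^sub>v v) ^^ k) v" for k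
  define a where "a i k = c k $ i / fact k" for i k
  define x where "x t = Matrix.vec n (\<lambda>i. \<Sum>k. a i k * of_real t ^ k)" for t
  have c: "c k \<in> carrier_vec n" for k
    unfolding c_def by (induction k) (use M v in auto)
  have c_Suc: "c (Suc k) = M *\<^sub>v c k" for k
    by (simp add: c_def)
  obtain K b where b: "\<And>k i. i < n \<Longrightarrow> norm (c k $ i) \<le> K * b ^ k"
    using mat_vec_power_bound[OF M v] unfolding c_def by metis
  \<comment> \<open>Each entry is dominated by \<open>K\<close> times the exponential series at
    \<open>b * norm z\<close>. Complex \<open>z\<close> are covered because termwise differentiation
    takes place in the complex plane.\<close>
  have summ: "summable (\<lambda>k. a i k * z ^ k)" if i: "i < n" for i and z :: complex
  proof (rule summable_comparison_test')
    show "summable (\<lambda>k. K * (inverse (fact k) * (b * norm z) ^ k))"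
      by (intro summable_mult summable_exp)
    show "norm (a i k * z ^ k) \<le> K * (inverse (fact k) * (b * norm z) ^ k)" for k
      using mult_right_mono[OF b[OF i, of k], of "inverse (fact k) * norm z ^ k"]
      by (simp add: a_def norm_mult norm_divide norm_power field_simps)
  qed
  \<comment> \<open>The factor \<open>Suc k\<close> produced by differentiation cancels against
    \<open>fact (Suc k)\<close>, leaving \<open>c (Suc k) = M *\<^sub>v c k\<close> over
    \<open>fact k\<close>: differentiating the series applies \<open>M\<close> once.\<close>
  have diffs: "diffs (a i) k = (\<Sum>j<n. M $$ (i, j) * a j k)" if i: "i < n" for i k
  proof -
    have "diffs (a i) k = c (Suc k) $ i / fact k"
      by (simp add: diffs_def a_def field_simps del: of_nat_Suc)
    also have "\<dots> = (\<Sum>j<n. M $$ (i, j) * a j k)"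
      by (simp add: a_def c_Suc index_mult_mat_vec_sum[OF M c i] sum_divide_distrib)
    finally show ?thesis .
  qed
  have deriv: "((\<lambda>\<tau>. x \<tau> $ i) has_vector_derivative (M *\<^sub>v x t) $ i) (at t within S)"
    if i: "i < n" for t i S
  proof -
    have "(\<Sum>k. diffs (a i) k * of_real t ^ k) = (\<Sum>k. \<Sum>j<n. M $$ (i, j) * (a j k * of_real t ^ k))"
      by (simp add: diffs[OF i] sum_distrib_right mult.assoc)
    also have "\<dots> = (\<Sum>j<n. M $$ (i, j) * (\<Sum>k. a j k * of_real t ^ k))"
      using summ by (subst suminf_sum) (auto intro!: sum.cong suminf_mult summable_mult)
    also have "\<dots> = (M *\<^sub>v x t) $ i"
      using i by (subst index_mult_mat_vec_sum[OF M]) (auto simp: x_def)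
    finally have "(\<Sum>k. diffs (a i) k * of_real t ^ k) = (M *\<^sub>v x t) $ i" .
    \<comment> \<open>The everywhere convergent series has a complex derivative, which restricts to
      a vector derivative along the real line, within any set.\<close>
    with has_vector_derivative_real_field[OF termdiffs_strong_converges_everywhere[OF summ[OF i]], of t S]
    show ?thesis using i by (simp add: x_def)
  qed
  show thesis
  proof
    show "x 0 = v"
    proof (rule eq_vecI)
      fix i assume "i < dim_vec v"
      thus "x 0 $ i = v $ i"
        using v powser_zero[of "a i"] by (simp add: x_def a_def c_def)
    qed (use v in \<open>simp add: x_def\<close>)
    show "vec_ode n x (\<lambda>t. M *\<^sub>v x t)"
      unfolding vec_ode_def using M deriv by (auto simp: x_def)
  qed (simp add: x_def)
qed

section \<open>Existence of trajectories with prescribed initial states\<close>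

lemma vec_ode_appendD:
  assumes z: "vec_ode (n + m) z (\<lambda>t. f t @\<^sub>v g t)"
    and f: "\<And>t. f t \<in> carrier_vec n" and g: "\<And>t. g t \<in> carrier_vec m"
  shows "vec_ode n (\<lambda>t. vec_first (z t) n) f" "vec_ode m (\<lambda>t. vec_last (z t) m) g"
proof -
  have deriv: "((\<lambda>\<tau>. z \<tau> $ i) has_vector_derivative (f t @\<^sub>v g t) $ i) (at t within {0..})"
    if "t \<ge> 0" "i < n + m" for t i
    using z that by (auto simp: vec_ode_def)
  have dims: "dim_vec (f t) = n" "dim_vec (g t) = m" for t
    using f g by auto
  show "vec_ode n (\<lambda>t. vec_first (z t) n) f"
    unfolding vec_ode_def
  proof (intro allI impI conjI)
    fix t :: real and i assume "t \<ge> 0" "i < n"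
    thus "((\<lambda>\<tau>. vec_first (z \<tau>) n $ i) has_vector_derivative f t $ i) (at t within {0..})"
      using deriv[of t i] by (simp add: vec_first_def dims)
  qed (use f in auto)
  have dim_z: "dim_vec (z t) = n + m" if "t \<ge> 0" for t
    using z that by (auto simp: vec_ode_def)
  show "vec_ode m (\<lambda>t. vec_last (z t) m) g"
    unfolding vec_ode_def
  proof (intro allI impI conjI)
    fix t :: real and i assume t: "t \<ge> 0" and i: "i < m"
    have "((\<lambda>\<tau>. z \<tau> $ (n + i)) has_vector_derivative g t $ i) (at t within {0..})"
      using deriv[of t "n + i"] t i by (simp add: dims)
    \<comment> \<open>The offset used by \<open>vec_last\<close> depends on the dimension of
      \<open>z \<tau>\<close>, which is known only for nonnegative \<tau>; \<open>vec_first\<close>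
      has no such dependence.\<close>
    thus "((\<lambda>\<tau>. vec_last (z \<tau>) m $ i) has_vector_derivative g t $ i) (at t within {0..})"
      by (rule has_vector_derivative_transform[rotated 2]) (use t i in \<open>auto simp: vec_last_def dim_z\<close>)
  qed (use g in auto)
qed

text \<open>This makes the quantification over trajectories informative: every pair of states can be
  realized at time 0. The generator may be started at rest, as its initial state is free.\<close>

lemma derivative_interconnection_exists:
  assumes F: "F \<in> carrier_mat \<nu> \<nu>" and G: "G \<in> carrier_mat \<nu> m" and H: "H \<in> carrier_mat p \<nu>"
    and S: "S \<in> carrier_mat \<nu> \<nu>" and L: "L \<in> carrier_mat m \<nu>"
    and D: "D \<in> carrier_mat \<mu> \<mu>" and R: "R \<in> carrier_mat \<mu> p"
    and \<xi>\<^sub>0: "\<xi>\<^sub>0 \<in> carrier_vec \<nu>" and \<chi>\<^sub>0: "\<chi>\<^sub>0 \<in> carrier_vec \<nu>"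
  obtains \<omega> \<xi> \<chi> \<phi> where "derivative_interconnection \<nu> \<mu> F G H S L D R \<omega> \<xi> \<chi> \<phi>"
    and "\<xi> 0 = \<xi>\<^sub>0" "\<chi> 0 = \<chi>\<^sub>0"
proof -
  \<comment> \<open>the interconnection with \<open>\<omega> = 0\<close>, as one autonomous system with state \<open>(\<xi>, \<chi>, \<phi>)\<close>\<close>
  define J where "J = four_block_mat F (0\<^sub>m \<nu> \<mu>) (R * H) D"
  define K where "K = 1\<^sub>m \<nu> @\<^sub>r (0\<^sub>m \<mu> \<nu> :: complex mat)"
  define M where "M = four_block_mat F (0\<^sub>m \<nu> (\<nu> + \<mu>)) K J"
  have RH: "R * H \<in> carrier_mat \<mu> \<nu>" using R H by auto
  have J: "J \<in> carrier_mat (\<nu> + \<mu>) (\<nu> + \<mu>)" unfolding J_def using F D by auto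
  have K: "K \<in> carrier_mat (\<nu> + \<mu>) \<nu>" unfolding K_def by auto
  have M: "M \<in> carrier_mat (\<nu> + (\<nu> + \<mu>)) (\<nu> + (\<nu> + \<mu>))" unfolding M_def using F J by auto
  obtain z where z0: "z 0 = \<xi>\<^sub>0 @\<^sub>v \<chi>\<^sub>0 @\<^sub>v 0\<^sub>v \<mu>" and z: "vec_ode (\<nu> + (\<nu> + \<mu>)) z (\<lambda>t. M *\<^sub>v z t)"
    and z_carrier: "\<And>t. z t \<in> carrier_vec (\<nu> + (\<nu> + \<mu>))"
    using \<xi>\<^sub>0 \<chi>\<^sub>0 by (elim linear_vec_ode_solvable[OF M, of "\<xi>\<^sub>0 @\<^sub>v \<chi>\<^sub>0 @\<^sub>v 0\<^sub>v \<mu>", rotated]) auto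
  define \<xi> where "\<xi> t = vec_first (z t) \<nu>" for t
  define y where "y t = vec_last (z t) (\<nu> + \<mu>)" for t
  define \<chi> where "\<chi> t = vec_first (y t) \<nu>" for t
  define \<phi> where "\<phi> t = vec_last (y t) \<mu>" for t
  have carrier: "\<xi> t \<in> carrier_vec \<nu>" "\<chi> t \<in> carrier_vec \<nu>" "\<phi> t \<in> carrier_vec \<mu>"
    "y t \<in> carrier_vec (\<nu> + \<mu>)" for t
    by (auto simp: \<xi>_def \<chi>_def \<phi>_def y_def)
  \<comment> \<open>Since \<open>z_carrier\<close> holds at all real times, the splittings are
    unconditional, and \<open>Mz\<close> and \<open>KJ\<close> can be unfolded beneath the time
    abstraction in the equations for \<open>z\<close> and \<open>y\<close>.\<close>
  have z_split: "z t = \<xi> t @\<^sub>v y t" for t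
    unfolding \<xi>_def y_def by (rule vec_first_last_append[OF z_carrier, symmetric])
  have y_split: "y t = \<chi> t @\<^sub>v \<phi> t" for t
    unfolding \<chi>_def \<phi>_def by (rule vec_first_last_append[OF carrier(4), symmetric])
  have Jy: "J *\<^sub>v y t = F *\<^sub>v \<chi> t @\<^sub>v ((R * H) *\<^sub>v \<chi> t + D *\<^sub>v \<phi> t)" for t
    unfolding y_split J_def using carrier F
    by (subst four_block_mat_mult_vec[OF F _ RH D, of _ "\<chi> t" "\<phi> t"]) auto
  have K\<xi>: "K *\<^sub>v \<xi> t = \<xi> t @\<^sub>v 0\<^sub>v \<mu>" for t
    unfolding K_def using carrier by (subst mat_mult_append[of _ \<nu> \<nu>]) auto
  have KJ: "K *\<^sub>v \<xi> t + J *\<^sub>v y t = (\<xi> t + F *\<^sub>v \<chi> t) @\<^sub>v ((R * H) *\<^sub>v \<chi> t + D *\<^sub>v \<phi> t)" for t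
    unfolding Jy K\<xi> using carrier F RH D by (subst append_vec_add[of _ \<nu> _ _ \<mu>]) auto
  have Mz: "M *\<^sub>v z t = F *\<^sub>v \<xi> t @\<^sub>v (K *\<^sub>v \<xi> t + J *\<^sub>v y t)" for t
    unfolding z_split M_def using carrier F
    by (subst four_block_mat_mult_vec[OF F _ K J, of _ "\<xi> t" "y t"]) auto
  have \<xi>_ode: "vec_ode \<nu> \<xi> (\<lambda>t. F *\<^sub>v \<xi> t)"
    and y_ode: "vec_ode (\<nu> + \<mu>) y (\<lambda>t. K *\<^sub>v \<xi> t + J *\<^sub>v y t)"
    using vec_ode_appendD[OF z[unfolded Mz]] carrier F J K unfolding \<xi>_def[symmetric] y_def[symmetric]
    by (auto intro: add_carrier_vec mult_mat_vec_carrier)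
  have \<chi>_ode: "vec_ode \<nu> \<chi> (\<lambda>t. \<xi> t + F *\<^sub>v \<chi> t)"
    and \<phi>_ode: "vec_ode \<mu> \<phi> (\<lambda>t. (R * H) *\<^sub>v \<chi> t + D *\<^sub>v \<phi> t)"
    using vec_ode_appendD[OF y_ode[unfolded KJ]] carrier F RH D unfolding \<chi>_def[symmetric] \<phi>_def[symmetric]
    by (auto intro: add_carrier_vec mult_mat_vec_carrier)
  have z0': "\<xi> 0 = \<xi>\<^sub>0" "\<chi> 0 = \<chi>\<^sub>0" "\<phi> 0 = 0\<^sub>v \<mu>"
  proof -
    have "\<xi> 0 = \<xi>\<^sub>0 \<and> y 0 = \<chi>\<^sub>0 @\<^sub>v 0\<^sub>v \<mu>"
      using z0 append_vec_eq[OF carrier(1) \<xi>\<^sub>0] unfolding z_split by simp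
    moreover from this have "\<chi> 0 = \<chi>\<^sub>0 \<and> \<phi> 0 = 0\<^sub>v \<mu>"
      using append_vec_eq[OF carrier(2) \<chi>\<^sub>0] unfolding y_split by simp
    ultimately show "\<xi> 0 = \<xi>\<^sub>0" "\<chi> 0 = \<chi>\<^sub>0" "\<phi> 0 = 0\<^sub>v \<mu>" by auto
  qed
  \<comment> \<open>With the generator at rest the input term vanishes, so the autonomous equation
    for \<xi> is also the driven one.\<close>
  have "vec_ode \<nu> \<xi> (\<lambda>t. F *\<^sub>v \<xi> t + G *\<^sub>v (L *\<^sub>v 0\<^sub>v \<nu>))"
    by (rule vec_ode_cong[OF \<xi>_ode]) (simp_all add: mult_mat_zero_vec[OF L] mult_mat_zero_vec[OF G]
        right_zero_vec[OF mult_mat_vec_carrier[OF F carrier(1)]])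
  moreover have "vec_ode \<nu> \<chi> (\<lambda>t. F *\<^sub>v \<chi> t + \<xi> t)"
    by (rule vec_ode_cong[OF \<chi>_ode])
      (auto intro: comm_add_vec[OF carrier(1) mult_mat_vec_carrier[OF F carrier(2)]])
  moreover have "vec_ode \<mu> \<phi> (\<lambda>t. D *\<^sub>v \<phi> t + R *\<^sub>v (- (- (H *\<^sub>v \<chi> t))))"
    by (rule vec_ode_cong[OF \<phi>_ode]) (use R H D carrier in \<open>auto intro: comm_add_vec\<close>)
  moreover have "vec_ode \<nu> (\<lambda>t. 0\<^sub>v \<nu>) (\<lambda>t. S *\<^sub>v 0\<^sub>v \<nu>)"
    using S by (auto simp: vec_ode_def mult_mat_zero_vec)
  ultimately have "derivative_interconnection \<nu> \<mu> F G H S L D R (\<lambda>t. 0\<^sub>v \<nu>) \<xi> \<chi> \<phi>"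
    unfolding derivative_interconnection_def using z0'(3) by simp
  thus thesis using z0' that by blast
qed

section \<open>Equality of matrices, and observability\<close>

lemma eq_mat_mult_vecI:
  fixes A B :: "'a :: semiring_1 mat"
  assumes A: "A \<in> carrier_mat m n" and B: "B \<in> carrier_mat m n"
    and eq: "\<And>v. v \<in> carrier_vec n \<Longrightarrow> A *\<^sub>v v = B *\<^sub>v v"
  shows "A = B"
proof (rule eq_matI)
  fix i j assume "i < dim_row B" "j < dim_col B"
  hence i: "i < m" and j: "j < n" using B by auto
  have "(A *\<^sub>v unit_vec n j) $ i = (B *\<^sub>v unit_vec n j) $ i"
    by (simp add: eq)
  thus "A $$ (i, j) = B $$ (i, j)"
    using A B i j by (simp add: scalar_prod_right_unit)
qed (use A B in auto)

text \<open>A zero output matrix makes every block \<open>C * A ^\<^sub>m k\<close> vanish, so the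
  observability matrix has rank 0 rather than the required positive rank \<open>n\<close>.\<close>

lemma observable_imp_nonzero:
  fixes C A :: "'a :: field mat"
  assumes A: "A \<in> carrier_mat n n" and C: "C \<in> carrier_mat p n" and "observable C A" and "n > 0"
  shows "C \<noteq> 0\<^sub>m p n"
proof
  assume C0: "C = 0\<^sub>m p n"
  have "observability_mat C A = 0\<^sub>m (n * p) n"
  proof (rule eq_matI)
    fix i j assume "i < dim_row (0\<^sub>m (n * p) n :: 'a mat)" "j < dim_col (0\<^sub>m (n * p) n :: 'a mat)"
    hence ij: "i < n * p" "j < n" by auto
    hence "i mod p < p" by (cases p) auto
    moreover have "C * A ^\<^sub>m (i div p) = 0\<^sub>m p n"
      unfolding C0 by (rule left_mult_zero_mat) (rule pow_carrier_mat[OF A])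
    ultimately show "observability_mat C A $$ (i, j) = 0\<^sub>m (n * p) n $$ (i, j)"
      using ij A C by (simp add: observability_mat_def Let_def)
  qed (use A C in \<open>auto simp: observability_mat_def Let_def\<close>)
  hence "vec_space.rank (n * p) (observability_mat C A) = 0"
    by (simp add: vec_space.rank_0I)
  thus False using assms by (auto simp: observable_def)
qed

section \<open>From trajectories to matrix equations\<close>

text \<open>The generator signal enters only the equation for \<xi>, whereas \<zeta> is built from
  \<phi> and \<chi>. Its derivative is therefore linear in \<phi>, \<chi> and \<xi> alone; the two
  equations compare the coefficients of \<xi> and \<chi>.\<close>

lemma matching_condition_iff:
  assumes F: "F \<in> carrier_mat \<nu> \<nu>" and G: "G \<in> carrier_mat \<nu> m" and H: "H \<in> carrier_mat p \<nu>"
    and S: "S \<in> carrier_mat \<nu> \<nu>" and L: "L \<in> carrier_mat m \<nu>"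
    and D: "D \<in> carrier_mat \<mu> \<mu>" and R: "R \<in> carrier_mat \<mu> p"
    and P: "P \<in> carrier_mat \<mu> \<nu>" and N: "N \<in> carrier_mat \<mu> \<nu>"
  shows "(\<forall>\<omega> \<xi> \<chi> \<phi>. derivative_interconnection \<nu> \<mu> F G H S L D R \<omega> \<xi> \<chi> \<phi> \<longrightarrow>
      vec_ode \<mu> (\<lambda>t. \<phi> t + P *\<^sub>v \<chi> t) (\<lambda>t. D *\<^sub>v (\<phi> t + P *\<^sub>v \<chi> t) + N *\<^sub>v \<xi> t)) \<longleftrightarrow>
    P = N \<and> R * H + P * F = D * P" (is "?match \<longleftrightarrow> _")
proof -
  have RH: "R * H \<in> carrier_mat \<mu> \<nu>" and PF: "P * F \<in> carrier_mat \<mu> \<nu>"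
    and DP: "D * P \<in> carrier_mat \<mu> \<nu>"
    using R H P F D by auto
  have deriv: "vec_ode \<mu> (\<lambda>t. \<phi> t + P *\<^sub>v \<chi> t)
      (\<lambda>t. D *\<^sub>v \<phi> t + ((R * H + P * F) *\<^sub>v \<chi> t + P *\<^sub>v \<xi> t))"
    and target: "\<And>t. t \<ge> 0 \<Longrightarrow> D *\<^sub>v (\<phi> t + P *\<^sub>v \<chi> t) + N *\<^sub>v \<xi> t =
      D *\<^sub>v \<phi> t + ((D * P) *\<^sub>v \<chi> t + N *\<^sub>v \<xi> t)"
    if "derivative_interconnection \<nu> \<mu> F G H S L D R \<omega> \<xi> \<chi> \<phi>" for \<omega> \<xi> \<chi> \<phi>
  proof -
    have \<xi>: "vec_ode \<nu> \<xi> (\<lambda>t. F *\<^sub>v \<xi> t + G *\<^sub>v (L *\<^sub>v \<omega> t))"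
      and \<chi>: "vec_ode \<nu> \<chi> (\<lambda>t. F *\<^sub>v \<chi> t + \<xi> t)"
      and \<phi>: "vec_ode \<mu> \<phi> (\<lambda>t. D *\<^sub>v \<phi> t + R *\<^sub>v (- (- (H *\<^sub>v \<chi> t))))"
      using that by (auto simp: derivative_interconnection_def Let_def)
    have carrier: "\<xi> t \<in> carrier_vec \<nu>" "\<chi> t \<in> carrier_vec \<nu>" "\<phi> t \<in> carrier_vec \<mu>" if "t \<ge> 0" for t
      using \<xi> \<chi> \<phi> that by (auto simp: vec_ode_def)
    show "vec_ode \<mu> (\<lambda>t. \<phi> t + P *\<^sub>v \<chi> t) (\<lambda>t. D *\<^sub>v \<phi> t + ((R * H + P * F) *\<^sub>v \<chi> t + P *\<^sub>v \<xi> t))"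
    proof (rule vec_ode_cong[OF vec_ode_add[OF \<phi> vec_ode_mult_mat[OF P \<chi>]] refl])
      fix t :: real assume "t \<ge> 0"
      note c = carrier[OF this]
      have "D *\<^sub>v \<phi> t + R *\<^sub>v (- (- (H *\<^sub>v \<chi> t))) + P *\<^sub>v (F *\<^sub>v \<chi> t + \<xi> t) =
          (D *\<^sub>v \<phi> t + (R * H) *\<^sub>v \<chi> t) + ((P * F) *\<^sub>v \<chi> t + P *\<^sub>v \<xi> t)"
        using c F P R H by (simp add: mult_add_distrib_mat_vec[OF P])
      also have "\<dots> = D *\<^sub>v \<phi> t + ((R * H + P * F) *\<^sub>v \<chi> t + P *\<^sub>v \<xi> t)"
        using c D RH PF P by (intro eq_vecI) (auto simp: add_mult_distrib_mat_vec[OF RH PF])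
      finally show "D *\<^sub>v \<phi> t + R *\<^sub>v (- (- (H *\<^sub>v \<chi> t))) + P *\<^sub>v (F *\<^sub>v \<chi> t + \<xi> t) =
        D *\<^sub>v \<phi> t + ((R * H + P * F) *\<^sub>v \<chi> t + P *\<^sub>v \<xi> t)" .
    qed
    show "D *\<^sub>v (\<phi> t + P *\<^sub>v \<chi> t) + N *\<^sub>v \<xi> t = D *\<^sub>v \<phi> t + ((D * P) *\<^sub>v \<chi> t + N *\<^sub>v \<xi> t)" if "t \<ge> 0" for t
    proof -
      note c = carrier[OF that]
      have "D *\<^sub>v (\<phi> t + P *\<^sub>v \<chi> t) = D *\<^sub>v \<phi> t + (D * P) *\<^sub>v \<chi> t"
        using c D P by (simp add: mult_add_distrib_mat_vec[OF D])
      thus ?thesis using c D DP N by (simp add: assoc_add_vec[of _ \<mu>])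
    qed
  qed
  show ?thesis
  proof
    assume ?match
    \<comment> \<open>Both expressions for the derivative of \<zeta> are compared at time 0, where
      \<chi> and \<xi> take the chosen values \<open>v\<close> and \<open>w\<close>, and \<phi>
      vanishes.\<close>
    have key: "(R * H + P * F) *\<^sub>v v + P *\<^sub>v w = (D * P) *\<^sub>v v + N *\<^sub>v w"
      if v: "v \<in> carrier_vec \<nu>" and w: "w \<in> carrier_vec \<nu>" for v w
    proof -
      obtain \<omega> \<xi> \<chi> \<phi> where tr: "derivative_interconnection \<nu> \<mu> F G H S L D R \<omega> \<xi> \<chi> \<phi>"
        and init: "\<xi> 0 = w" "\<chi> 0 = v"
        using derivative_interconnection_exists[OF F G H S L D R w v] by blast
      have \<phi>0: "\<phi> 0 = 0\<^sub>v \<mu>" using tr by (simp add: derivative_interconnection_def Let_def)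
      have "D *\<^sub>v 0\<^sub>v \<mu> = 0\<^sub>v \<mu>" using D by (rule mult_mat_zero_vec)
      with vec_ode_unique_at_0[OF deriv[OF tr] \<open>?match\<close>[rule_format, OF tr]]
      show ?thesis
        using target[OF tr, of 0] RH PF DP P N v w add_carrier_mat[OF PF, of "R * H"]
        by (simp add: init \<phi>0 left_zero_vec[OF add_carrier_vec[OF mult_mat_vec_carrier mult_mat_vec_carrier]])
    qed
    \<comment> \<open>Taking \<open>v\<close> to be zero isolates the coefficient of \<xi>; below,
      taking \<open>w\<close> to be zero isolates that of \<chi>.\<close>
    have "P = N"
    proof (rule eq_mat_mult_vecI[OF P N])
      fix w :: "complex vec" assume w: "w \<in> carrier_vec \<nu>"
      have "(R * H + P * F) *\<^sub>v 0\<^sub>v \<nu> = 0\<^sub>v \<mu>" "(D * P) *\<^sub>v 0\<^sub>v \<nu> = 0\<^sub>v \<mu>"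
        using RH PF DP by (auto intro: mult_mat_zero_vec)
      thus "P *\<^sub>v w = N *\<^sub>v w" using key[of "0\<^sub>v \<nu>" w] P N w by simp
    qed
    moreover have "R * H + P * F = D * P"
    proof (rule eq_mat_mult_vecI[OF _ DP])
      fix v :: "complex vec" assume v: "v \<in> carrier_vec \<nu>"
      have "P *\<^sub>v 0\<^sub>v \<nu> = 0\<^sub>v \<mu>" "N *\<^sub>v 0\<^sub>v \<nu> = 0\<^sub>v \<mu>" using P N by (auto intro: mult_mat_zero_vec)
      moreover have "(R * H + P * F) *\<^sub>v v \<in> carrier_vec \<mu>" "(D * P) *\<^sub>v v \<in> carrier_vec \<mu>"
        using mult_mat_vec_carrier[OF add_carrier_mat[OF PF] v] mult_mat_vec_carrier[OF DP v] by auto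
      ultimately show "(R * H + P * F) *\<^sub>v v = (D * P) *\<^sub>v v" using key[OF v, of "0\<^sub>v \<nu>"] by simp
    qed (use RH PF in auto)
    ultimately show "P = N \<and> R * H + P * F = D * P" ..
  next
    assume "P = N \<and> R * H + P * F = D * P"
    hence N_eq: "N = P" and eq: "R * H + P * F = D * P" by auto
    show ?match
    proof (intro allI impI)
      fix \<omega> \<xi> \<chi> \<phi> assume tr: "derivative_interconnection \<nu> \<mu> F G H S L D R \<omega> \<xi> \<chi> \<phi>"
      show "vec_ode \<mu> (\<lambda>t. \<phi> t + P *\<^sub>v \<chi> t) (\<lambda>t. D *\<^sub>v (\<phi> t + P *\<^sub>v \<chi> t) + N *\<^sub>v \<xi> t)"
      proof (rule vec_ode_cong[OF deriv[OF tr] refl])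
        fix t :: real assume "t \<ge> 0"
        from target[OF tr this]
        show "D *\<^sub>v \<phi> t + ((R * H + P * F) *\<^sub>v \<chi> t + P *\<^sub>v \<xi> t) =
            D *\<^sub>v (\<phi> t + P *\<^sub>v \<chi> t) + N *\<^sub>v \<xi> t"
          unfolding N_eq eq by (rule sym)
      qed
    qed
  qed
qed

section \<open>Sylvester equations and cancellation of the row\<close>

text \<open>Multiplying the equation for \<Upsilon> by \<open>P\<close> on the right and the one for
  \<open>P\<close> by \<Upsilon> on the left yields the common term
  \<open>\<Upsilon> * A * P\<close>. Eliminating it leaves the defect
  \<open>(\<Upsilon> * B - \<Upsilon> * P * G) * L\<close>, in distributed form.\<close>

lemma projected_dynamics_eq:
  fixes A B C D R S L G P \<Upsilon> :: "'a :: comm_ring_1 mat"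
  assumes A: "A \<in> carrier_mat n n" and B: "B \<in> carrier_mat n m" and C: "C \<in> carrier_mat p n"
    and S: "S \<in> carrier_mat \<nu> \<nu>" and L: "L \<in> carrier_mat m \<nu>" and G: "G \<in> carrier_mat \<nu> m"
    and D: "D \<in> carrier_mat \<mu> \<mu>" and R: "R \<in> carrier_mat \<mu> p"
    and P: "P \<in> carrier_mat n \<nu>" and \<Upsilon>: "\<Upsilon> \<in> carrier_mat \<mu> n"
    and P_eq: "A * P + B * L = P * S" and \<Upsilon>_eq: "D * \<Upsilon> = \<Upsilon> * A + R * C"
  shows "R * (C * P) + \<Upsilon> * P * (S - G * L) = D * (\<Upsilon> * P) + (\<Upsilon> * B * L - \<Upsilon> * P * G * L)"
proof -
  have "D * (\<Upsilon> * P) = (\<Upsilon> * A + R * C) * P"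
    using D \<Upsilon> P by (simp add: \<Upsilon>_eq[symmetric])
  also have "\<dots> = \<Upsilon> * A * P + R * C * P"
    using \<Upsilon> A R C P by (intro add_mult_distrib_mat) auto
  also have "\<dots> = \<Upsilon> * A * P + R * (C * P)"
    using R C P by simp
  finally have 1: "D * (\<Upsilon> * P) = \<Upsilon> * A * P + R * (C * P)" .
  have "\<Upsilon> * P * (S - G * L) = \<Upsilon> * P * S - \<Upsilon> * P * (G * L)"
    using \<Upsilon> P S G L by (intro mult_minus_distrib_mat[of _ \<mu> \<nu>]) auto
  also have "\<Upsilon> * P * S = \<Upsilon> * (A * P + B * L)"
    using \<Upsilon> P S by (simp add: P_eq)
  also have "\<dots> = \<Upsilon> * (A * P) + \<Upsilon> * (B * L)"
    using \<Upsilon> P A B L by (intro mult_add_distrib_mat[of _ \<mu> n]) auto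
  also have "\<Upsilon> * (A * P) = \<Upsilon> * A * P"
    using \<Upsilon> P A by simp
  also have "\<Upsilon> * (B * L) = \<Upsilon> * B * L"
    using \<Upsilon> B L by simp
  also have "\<Upsilon> * P * (G * L) = \<Upsilon> * P * G * L"
    using \<Upsilon> P G L by (intro assoc_mult_mat[symmetric]) auto
  finally have 2: "\<Upsilon> * P * (S - G * L) = \<Upsilon> * A * P + \<Upsilon> * B * L - \<Upsilon> * P * G * L" .
  have c: "\<Upsilon> * A * P \<in> carrier_mat \<mu> \<nu>" "R * (C * P) \<in> carrier_mat \<mu> \<nu>"
      "\<Upsilon> * B * L \<in> carrier_mat \<mu> \<nu>" "\<Upsilon> * P * G * L \<in> carrier_mat \<mu> \<nu>"
    using assms by auto
  show ?thesis
    \<comment> \<open>The products stay opaque, so that each entry is a purely additive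
      identity.\<close>
    unfolding 1 2 using c by (intro eq_matI) (auto simp del: index_mult_mat)
qed

text \<open>As \<open>X\<close> and \<open>Y\<close> are single columns, the products with
  \<open>L\<close> are outer products: in a column where \<open>L\<close> has a nonzero entry, that
  entry is a common factor and cancels.\<close>

lemma mult_nonzero_row_cancel:
  fixes X Y L :: "'a :: idom mat"
  assumes X: "X \<in> carrier_mat m 1" and Y: "Y \<in> carrier_mat m 1" and L: "L \<in> carrier_mat 1 n"
    and "L \<noteq> 0\<^sub>m 1 n" and eq: "X * L = Y * L"
  shows "X = Y"
proof -
  obtain k where k: "k < n" "L $$ (0, k) \<noteq> 0"
    using assms(3,4) by (metis carrier_matD eq_matI index_zero_mat less_one)
  show ?thesis
  proof (rule eq_matI)
    fix i j assume "i < dim_row Y" "j < dim_col Y"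
    hence i: "i < m" and j: "j = 0" using Y by auto
    have "(X * L) $$ (i, k) = (Y * L) $$ (i, k)" by (simp add: eq)
    thus "X $$ (i, j) = Y $$ (i, j)"
      using X Y L i j k by (simp add: scalar_prod_def)
  qed (use X Y in auto)
qed

section \<open>The criterion for matching\<close>

theorem theorem10:
  fixes n \<nu> \<mu> :: nat
    and A B C S\<^sub>D :: "real mat"
    and S S\<^sub>p L R G \<Pi>\<^sub>S \<Upsilon>\<^sub>D :: "complex mat"
    and L\<^sub>1 L\<^sub>2 :: "complex vec"
    and j :: "complex \<Rightarrow> nat"
  assumes A: "A \<in> carrier_mat n n"
    and B: "B \<in> carrier_mat n 1"
    and C: "C \<in> carrier_mat 1 n"
    and "controllable A B"
    and "observable C A"
    and "hurwitz_stable A"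
    and \<mu>_le: "\<mu> \<le> \<nu>"
    and S\<^sub>p: "S\<^sub>p \<in> carrier_mat (\<nu> - \<mu>) (\<nu> - \<mu>)"
    and S\<^sub>D: "S\<^sub>D \<in> carrier_mat \<mu> \<mu>"
    and S: "S = four_block_mat S\<^sub>p (0\<^sub>m (\<nu> - \<mu>) \<mu>) (0\<^sub>m \<mu> (\<nu> - \<mu>)) (complex_mat S\<^sub>D)"
    and "cnj ` spectrum S = spectrum S"
    and "spectrum S \<inter> spectrum (complex_mat A) = {}"
    and "\<forall>s \<in> spectrum S. Polynomial.order s (char_poly S) = j s + 1"
    and L\<^sub>1: "L\<^sub>1 \<in> carrier_vec (\<nu> - \<mu>)"
    and L\<^sub>2: "L\<^sub>2 \<in> carrier_vec \<mu>"
    and L: "L = mat_of_rows \<nu> [L\<^sub>1 @\<^sub>v L\<^sub>2]"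
    and "observable L S"
    and R: "R = mat_of_cols \<mu> [L\<^sub>2]"
    and "controllable (complex_mat S\<^sub>D) R"
    and G: "G \<in> carrier_mat \<nu> 1"
    and "spectrum (S - G * L) \<inter> spectrum S = {}"
    and \<Pi>\<^sub>S: "\<Pi>\<^sub>S \<in> carrier_mat n \<nu>"
    and "complex_mat A * \<Pi>\<^sub>S + complex_mat B * L = \<Pi>\<^sub>S * S"
    and \<Upsilon>\<^sub>D: "\<Upsilon>\<^sub>D \<in> carrier_mat \<mu> n"
    and "complex_mat S\<^sub>D * \<Upsilon>\<^sub>D = \<Upsilon>\<^sub>D * complex_mat A + R * complex_mat C"
  shows "higher_moments_match \<nu> \<mu> S L G (complex_mat C) (complex_mat S\<^sub>D) R \<Pi>\<^sub>S \<Upsilon>\<^sub>D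
     \<longleftrightarrow> \<Upsilon>\<^sub>D * \<Pi>\<^sub>S * G = \<Upsilon>\<^sub>D * complex_mat B"
proof -
  let ?A = "complex_mat A" and ?B = "complex_mat B" and ?C = "complex_mat C" and ?D = "complex_mat S\<^sub>D"
  note \<Pi>\<^sub>S_eq = \<open>?A * \<Pi>\<^sub>S + ?B * L = \<Pi>\<^sub>S * S\<close> and \<Upsilon>\<^sub>D_eq = \<open>?D * \<Upsilon>\<^sub>D = \<Upsilon>\<^sub>D * ?A + R * ?C\<close>
  let ?F = "S - G * L" and ?P = "\<Upsilon>\<^sub>D * \<Pi>\<^sub>S"
  have A': "?A \<in> carrier_mat n n" and B': "?B \<in> carrier_mat n 1" and C': "?C \<in> carrier_mat 1 n"
    and D': "?D \<in> carrier_mat \<mu> \<mu>"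
    using A B C S\<^sub>D by (simp_all only: map_carrier_mat)
  have S': "S \<in> carrier_mat \<nu> \<nu>"
    using four_block_carrier_mat[OF S\<^sub>p D'] \<mu>_le unfolding S by simp
  have L': "L \<in> carrier_mat 1 \<nu>" and R': "R \<in> carrier_mat \<mu> 1"
    using mat_of_rows_carrier(1)[of \<nu> "[L\<^sub>1 @\<^sub>v L\<^sub>2]"] mat_of_cols_carrier(1)[of \<mu> "[L\<^sub>2]"]
    by (simp_all add: L R)
  have F: "?F \<in> carrier_mat \<nu> \<nu>" and H: "?C * \<Pi>\<^sub>S \<in> carrier_mat 1 \<nu>"
    and P: "?P \<in> carrier_mat \<mu> \<nu>"
    using S' G L' C' \<Pi>\<^sub>S \<Upsilon>\<^sub>D by auto
  have \<Upsilon>B: "\<Upsilon>\<^sub>D * ?B \<in> carrier_mat \<mu> 1" and PG: "?P * G \<in> carrier_mat \<mu> 1"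
    using \<Upsilon>\<^sub>D B' P G by auto
  have "higher_moments_match \<nu> \<mu> S L G ?C ?D R \<Pi>\<^sub>S \<Upsilon>\<^sub>D \<longleftrightarrow>
      (\<exists>Q \<in> carrier_mat \<mu> \<nu>. Q = ?P \<and> R * (?C * \<Pi>\<^sub>S) + Q * ?F = ?D * Q)"
    unfolding higher_moments_match_def Let_def
    by (intro bex_cong refl matching_condition_iff[OF F G H S' L' D' R' _ P])
  \<comment> \<open>The coefficient of \<xi> has determined the witness, so the existential
    quantifier collapses to \<open>?P\<close>.\<close>
  also have "\<dots> \<longleftrightarrow> R * (?C * \<Pi>\<^sub>S) + ?P * ?F = ?D * ?P"
    using P by blast
  also have "\<dots> \<longleftrightarrow> ?D * ?P + (\<Upsilon>\<^sub>D * ?B * L - ?P * G * L) = ?D * ?P"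
    by (simp only: projected_dynamics_eq[OF A' B' C' S' L' G D' R' \<Pi>\<^sub>S \<Upsilon>\<^sub>D \<Pi>\<^sub>S_eq \<Upsilon>\<^sub>D_eq])
  also have "\<dots> \<longleftrightarrow> ?P * G * L = \<Upsilon>\<^sub>D * ?B * L"
  proof -
    have cancel: "X + (Y - Z) = X \<longleftrightarrow> Z = Y"
      if "X \<in> carrier_mat \<mu> \<nu>" "Y \<in> carrier_mat \<mu> \<nu>" "Z \<in> carrier_mat \<mu> \<nu>" for X Y Z :: "complex mat"
      using that by (auto simp: mat_eq_iff)
    show ?thesis
      using D' P \<Upsilon>B PG L' by (intro cancel) auto
  qed
  also have "\<dots> \<longleftrightarrow> ?P * G = \<Upsilon>\<^sub>D * ?B"
  proof
    assume eq: "?P * G * L = \<Upsilon>\<^sub>D * ?B * L"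
    show "?P * G = \<Upsilon>\<^sub>D * ?B"
    \<comment> \<open>Nonvanishing of \<open>L\<close> requires a generator of positive dimension.
      In dimension 0, \<open>\<mu>_le\<close> forces \<open>\<mu> = 0\<close>, and both sides are
      matrices without rows.\<close>
    proof (cases "\<nu> = 0")
      case True
      with \<mu>_le PG \<Upsilon>B G B' show ?thesis by (intro eq_matI) auto
    next
      case False
      with observable_imp_nonzero[OF S' L' \<open>observable L S\<close>] show ?thesis
        by (intro mult_nonzero_row_cancel[OF PG \<Upsilon>B L' _ eq]) simp
    qed
  qed simp
  finally show ?thesis .
qed

end
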